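(* Let $n\ge 3$ and let $\mathcal{S}$ be a multiset of $n^2$ integers satisfying $$\nu(\mathcal{S})\le n^2-3n+8.$$ Then $\mathcal{S}$ is $\mathrm{PSI}_n$ if and only if either it has at most one nonzero entry, or it has the form $$\mathcal{S}=\{a,b,0^{[n^2-2]}\},\qquad a,b\neq 0,\qquad ab=q^2 \text{ for some } q\in\mathbb{Z}.$$ In particular, no $\mathrm{PSI}_n$ multiset $\mathcal{S}$ has $3\le\nu(\mathcal{S})\le n^2-3n+8$.
   Context: For a multiset $\mathcal{S}$ of $n^2$ integers, $\mathcal{M}_n(\mathcal{S})$ denotes the set of all $n\times n$ integer matrices whose $n^2$ entries, counted with multiplicity, are exactly the elements of $\mathcal{S}$. A matrix has integral spectrum if all its eigenvalues are integers. $\mathcal{S}$ is permutation-spectrally integral in dimension $n$ ($\mathrm{PSI}_n$) if every matrix in $\mathcal{M}_n(\mathcal{S})$ has integral spectrum. The density $\nu(\mathcal{S})$ is the number of nonzero elements of $\mathcal{S}$, counted with multiplicity. The notation $x^{[m]}$ means $m$ copies of $x$. *)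

theory Defs
  imports "Jordan_Normal_Form.Spectral_Radius" "HOL-Library.Multiset"
begin

definition entries_mset :: "'a mat \<Rightarrow> 'a multiset" where
  "entries_mset A = image_mset (\<lambda>ij. A $$ ij) (mset_set ({..<dim_row A} \<times> {..<dim_col A}))"

definition mats_of :: "nat \<Rightarrow> int multiset \<Rightarrow> int mat set" where
  "mats_of n S = {A \<in> carrier_mat n n. entries_mset A = S}"

(* Eigenvalues are taken over the complex numbers: the spectrum of the
   integer matrix itself would contain only its integer eigenvalues. *)
definition integral_spectrum :: "int mat \<Rightarrow> bool" where
  "integral_spectrum A \<longleftrightarrow> spectrum (map_mat complex_of_int A) \<subseteq> \<int>"

(* Only meaningful for multisets of size n^2; for other sizes mats_of n S is
   empty and the condition is vacuous. *)
definition PSI :: "nat \<Rightarrow> int multiset \<Rightarrow> bool" where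
  "PSI n S \<longleftrightarrow> (\<forall>A \<in> mats_of n S. integral_spectrum A)"

definition density :: "int multiset \<Rightarrow> nat" where
  "density S = size (filter_mset (\<lambda>x. x \<noteq> 0) S)"

end

theory Submission
  imports Defs
begin

text \<open>
The heart of the matter is that three or more nonzero entries, together with \<open>3 * n - 8\<close> zeros, can
always be arranged so that some eigenvalue is not an integer. With \<open>3 * (n - 3)\<close> zeros the
matrix becomes block triangular with a leading \<open>3 \<times> 3\<close> block, whose eigenvalues are eigenvalues of
the matrix, and one zero remains to be placed inside of this block. So it suffices to find, for
eight integers of which at least three are nonzero, a \<open>3 \<times> 3\<close> matrix with these entries and one more
zero whose characteristic polynomial does not split over the integers.

The obstruction is 2-adic, and one arrangement serves all cases. Let \<open>s 0, ..., s 7\<close> be the eight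
integers in order of 2-adic valuation, zeros last, and put them into the matrix with rows
\<open>(s 3, s 0, s 7)\<close>, \<open>(0, s 4, s 1)\<close>, \<open>(s 2, s 6, s 5)\<close>. Dividing by a power of two one may take \<open>s 0\<close>
to be odd. If at least three entries are odd, the characteristic polynomial does not split
even modulo 2. Otherwise the 3-cycle \<open>s 0, s 1, s 2\<close> dominates the determinant, and the
Newton polygon at 2 is one segment, whose slope is fractional or whose residual polynomial is
\<open>X^3 + 1\<close>, which has an irreducible quadratic factor modulo 2.
This is \<open>cycle_block_not_split\<close>, and \<open>not_PSI_density_ge_3\<close> draws the conclusion for \<open>n \<times> n\<close> matrices.

With two nonzero entries \<open>a\<close> and \<open>b\<close> the only eigenvalues that can occur are \<open>0\<close>, \<open>a\<close>, \<open>b\<close> and the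
square roots of \<open>a * b\<close>, and the latter do occur when the entries are placed opposite to each other
(\<open>integral_spectrum_two_entries\<close>, \<open>PSI_two_entries_imp_square\<close>).
\<close>

section \<open>Cubics that split over the integers\<close>

text \<open>The condition that \<open>X^3 - e1 X^2 + e2 X - e3\<close> is a product of three linear factors
over the integers, phrased by the elementary symmetric functions of the roots.\<close>

definition splits_over_int :: "int \<Rightarrow> int \<Rightarrow> int \<Rightarrow> bool" where
  "splits_over_int e1 e2 e3 \<longleftrightarrow>
     (\<exists>x y z. e1 = x + y + z \<and> e2 = x*y + x*z + y*z \<and> e3 = x*y*z)"

text \<open>This is a descent step. An even product makes one root even; then the other two have an even sum
and an even product, so they are even as well, and all three roots can be halved. Iterated,
it allows a common power of two to be removed from all entries of a matrix.\<close>

lemma splits_over_int_half: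
  assumes "splits_over_int (2 * e1) (4 * e2) (8 * e3)"
  shows "splits_over_int e1 e2 e3"
proof -
  obtain x y z where xyz: "2 * e1 = x + y + z" "4 * e2 = x*y + x*z + y*z" "8 * e3 = x*y*z"
    using assms unfolding splits_over_int_def by blast
  have "even (x + y + z)" "even (x*y + x*z + y*z)" "even (x*y*z)"
    by (simp_all flip: xyz)
  then have "even x" "even y" "even z" by auto
  then obtain x' y' z' where "x = 2 * x'" "y = 2 * y'" "z = 2 * z'"
    by (auto elim!: evenE)
  with xyz have "e1 = x' + y' + z'" "e2 = x'*y' + x'*z' + y'*z'" "e3 = x'*y'*z'"
    by auto
  then show ?thesis unfolding splits_over_int_def by blast
qed

lemma splits_over_int_descent:
  "splits_over_int (2^u * e1) (2^(2*u) * e2) (2^(3*u) * e3) \<Longrightarrow> splits_over_int e1 e2 e3"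
proof (induction u)
  case (Suc u)
  have *: "2^Suc u * e1 = 2 * (2^u * e1)" "2^(2 * Suc u) * e2 = 4 * (2^(2*u) * e2)"
    "2^(3 * Suc u) * e3 = 8 * (2^(3*u) * e3)" by (simp_all add: power_add)
  have "splits_over_int (2^u * e1) (2^(2*u) * e2) (2^(3*u) * e3)"
    using Suc.prems unfolding * by (rule splits_over_int_half)
  then show ?case by (rule Suc.IH)
qed simp

text \<open>Modulo 2 a cubic that splits is determined by the number of its odd roots. The four patterns
of \<open>(e1, e2, e3)\<close> that do not occur belong to the cubics over the field with two elements
that have an irreducible factor \<open>X^2 + X + 1\<close> or are themselves irreducible.\<close>

lemma splits_over_int_parity:
  assumes "splits_over_int e1 e2 e3"
  shows "(even e1 \<and> even e3) \<or> (odd e1 \<and> (even e2 \<longleftrightarrow> even e3))"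
proof -
  obtain x y z where "e1 = x + y + z" "e2 = x*y + x*z + y*z" "e3 = x*y*z"
    using assms unfolding splits_over_int_def by blast
  then show ?thesis by (cases "even x"; cases "even y"; cases "even z") simp_all
qed

lemma odd_part:
  fixes x :: int assumes "x \<noteq> 0"
  obtains i c where "x = 2^i * c" "odd c"
proof -
  have "\<not> is_unit (2::int)" by simp
  with assms show thesis using that by (rule multiplicity_decompose')
qed

lemma product_valuation:
  fixes i j k t :: nat and a b c d :: int
  assumes "(2::int)^i * a * (2^j * b) * (2^k * c) = 2^t * d" "odd a" "odd b" "odd c" "odd d"
  shows "t = i + j + k"
proof -
  have "multiplicity 2 ((2::int)^t * d) = t" using \<open>odd d\<close>
    by (intro multiplicity_eqI) auto
  moreover have "multiplicity 2 ((2::int)^(i+j+k) * (a*b*c)) = i+j+k" using assms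
    by (intro multiplicity_eqI) auto
  moreover have "(2::int)^t * d = 2^(i+j+k) * (a*b*c)"
    using assms(1) by (simp add: power_add mult_ac)
  ultimately show ?thesis by metis
qed

lemma pow2_dvd_odd: "odd (a::int) \<Longrightarrow> (2::int)^k dvd 2^i * a \<Longrightarrow> k \<le> i"
proof (rule ccontr)
  assume a: "odd a" and d: "(2::int)^k dvd 2^i * a" and "\<not> k \<le> i"
  then have "(2::int)^(Suc i) dvd 2^i * a" by (meson not_less_eq_eq power_le_dvd)
  then show False using a by auto
qed

text \<open>The hypotheses say that the 2-adic Newton polygon of the cubic with roots \<open>x, y, z\<close> is a single
segment of slope \<open>t/3\<close> and that, when \<open>t > 0\<close> is divisible by \<open>3\<close>, the residual polynomial is
\<open>X^3 + 1\<close>, which does not split over the field with two elements. In elementary terms, the least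
of the three root valuations is at most \<open>t/3 < l\<close>, so it must occur an even number of times for
\<open>2^l\<close> to divide the sum. Hence it occurs exactly twice, and then \<open>x*y\<close> is the only term of
least valuation in the second symmetric function, and this valuation is less than \<open>t\<close>.\<close>

lemma no_sorted_roots_single_slope:
  fixes a b c :: int
  assumes odd: "odd a" "odd b" "odd c" and ij: "i \<le> j" and jk: "j \<le> k"
    and x: "x = 2^i * a" and y: "y = 2^j * b" and z: "z = 2^k * c"
    and e1: "(2::int)^l dvd x + y + z"
    and e2: "(2::int)^t dvd x*y + x*z + y*z"
    and e3: "x*y*z = 2^t * d" "odd d"
    and l: "0 < l" "t \<le> 2 * l"
  shows False
proof -
  have t: "t = i + j + k"
    using e3 odd unfolding x y z by (intro product_valuation[of i a j b k c t d]) auto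
  have il: "Suc i \<le> l" using t ij jk l by linarith
  have s1: "(2::int)^Suc i dvd x + y + z" using e1 il by (meson power_le_dvd)
  show False
  proof (cases "i < j")
    case True
    then have "(2::int)^Suc i dvd y" "(2::int)^Suc i dvd z"
      unfolding y z using jk by (intro dvd_mult2 le_imp_power_dvd; simp)+
    with s1 have "(2::int)^Suc i dvd x"
      by (metis dvd_add_left_iff)
    then show False using pow2_dvd_odd[OF odd(1)] unfolding x by fastforce
  next
    case False
    with ij have j: "j = i" by simp
    show False
    proof (cases "i < k")
      case True
      have "(2::int)^Suc (i+i) dvd 2^(i+k)" using True by (intro le_imp_power_dvd) auto
      moreover have "x*z = 2^(i+k) * (a*c)" "y*z = 2^(i+k) * (b*c)"
        unfolding x y z j by (simp_all add: power_add)
      ultimately have "(2::int)^Suc (i+i) dvd x*z" "(2::int)^Suc (i+i) dvd y*z"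
        by (metis dvd_mult2)+
      moreover have "(2::int)^Suc (i+i) dvd x*y + x*z + y*z"
        using True t j by (intro dvd_trans[OF _ e2] le_imp_power_dvd) auto
      ultimately have "(2::int)^Suc (i+i) dvd x*y" by (metis dvd_add_left_iff)
      moreover have "x*y = 2^(i+i) * (a*b)" unfolding x y j by (simp add: power_add)
      ultimately show False using pow2_dvd_odd[of "a*b" "Suc (i+i)" "i+i"] odd by auto
    next
      case False
      then have "x + y + z = 2^i * (a+b+c)" unfolding x y z using j jk by (simp add: algebra_simps)
      with s1 have "Suc i \<le> i" using pow2_dvd_odd[of "a+b+c" "Suc i" i] odd by auto
      then show False by simp
    qed
  qed
qed

lemma not_split_single_slope:
  assumes e1: "(2::int)^l dvd e1"
    and e2: "(2::int)^t dvd e2"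
    and e3: "e3 = 2^t * d" "odd d"
    and l: "0 < l" "t \<le> 2 * l"
  shows "\<not> splits_over_int e1 e2 e3"
proof
  assume "splits_over_int e1 e2 e3"
  then obtain x y z where E: "e1 = x + y + z" "e2 = x*y + x*z + y*z" "e3 = x*y*z"
    unfolding splits_over_int_def by blast
  have "d \<noteq> 0" using e3(2) by auto
  then have "x \<noteq> 0" "y \<noteq> 0" "z \<noteq> 0" using E(3) e3 by auto
  then obtain i j k a b c where xyz: "x = 2^i * a" "odd a" "y = 2^j * b" "odd b" "z = 2^k * c" "odd c"
    by (metis odd_part)
  note R = no_sorted_roots_single_slope[OF _ _ _ _ _ refl refl refl _ _ _ e3(2) l]
  have E': "x*y*z = 2^t * d" "2^t dvd x*y + x*z + y*z" "2^l dvd x + y + z"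
    using E e1 e2 e3 by auto
  consider "i \<le> j \<and> j \<le> k" | "i \<le> k \<and> k \<le> j" | "j \<le> i \<and> i \<le> k" | "j \<le> k \<and> k \<le> i"
    | "k \<le> i \<and> i \<le> j" | "k \<le> j \<and> j \<le> i" by linarith
  then show False
  proof cases
    case 1 then show False using R[of a b c i j k] E' xyz by auto
  next
    case 2 then show False using R[of a c b i k j] E' xyz by (auto simp: ac_simps)
  next
    case 3 then show False using R[of b a c j i k] E' xyz by (auto simp: ac_simps)
  next
    case 4 then show False using R[of b c a j k i] E' xyz by (auto simp: ac_simps)
  next
    case 5 then show False using R[of c a b k i j] E' xyz by (auto simp: ac_simps)
  next
    case 6 then show False using R[of c b a k j i] E' xyz by (auto simp: ac_simps)
  qed
qed

section \<open>The arrangement in dimension three\<close>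

text \<open>These are the trace, the sum of the principal \<open>2 \<times> 2\<close> minors and the determinant of the matrix
with rows \<open>(s 3, s 0, s 7)\<close>, \<open>(0, s 4, s 1)\<close> and \<open>(s 2, s 6, s 5)\<close>. The entries \<open>s 0, s 1, s 2\<close>
form a 3-cycle, the next three fill the diagonal, and the only position without a variable
is opposite to \<open>s 0\<close>, so \<open>s 0\<close> enters the three values through \<open>s 0 * s 1 * s 2\<close> alone.\<close>

definition cycle_trace :: "(nat \<Rightarrow> int) \<Rightarrow> int" where
  "cycle_trace s = s 3 + s 4 + s 5"

definition cycle_minors :: "(nat \<Rightarrow> int) \<Rightarrow> int" where
  "cycle_minors s = s 3 * s 4 + s 3 * s 5 + s 4 * s 5 - s 7 * s 2 - s 1 * s 6"

definition cycle_det :: "(nat \<Rightarrow> int) \<Rightarrow> int" where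
  "cycle_det s = s 0 * s 1 * s 2 + s 3 * s 4 * s 5 - s 3 * s 1 * s 6 - s 7 * s 4 * s 2"

text \<open>The first eight terms are in order of 2-adic valuation. Divisibility by powers of two expresses
this with \<open>0\<close> automatically last.\<close>

definition sorted_2adic :: "(nat \<Rightarrow> int) \<Rightarrow> bool" where
  "sorted_2adic s \<longleftrightarrow> (\<forall>i j k. i \<le> j \<longrightarrow> j < 8 \<longrightarrow> 2^k dvd s i \<longrightarrow> 2^k dvd s j)"

text \<open>Suppose first that \<open>s 2\<close> is odd. The odd entries are then an initial segment of length 3 to 8,
and in each of these six cases the characteristic polynomial does not split modulo 2.
Suppose next that \<open>s 2\<close> is even, of valuation \<open>l\<close>, and let \<open>m \<le> l\<close> be the valuation of \<open>s 1\<close>.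
The diagonal is divisible by \<open>2^l\<close>. Every product in the other two coefficients is divisible by
\<open>2^(m+l)\<close>, and \<open>s 0 * s 1 * s 2\<close> is the only term of the determinant whose valuation
is exactly \<open>m + l\<close>.\<close>

lemma cycle_block_not_split_odd:
  assumes s: "sorted_2adic s" and s0: "odd (s 0)" and s2: "s 2 \<noteq> 0"
  shows "\<not> splits_over_int (cycle_trace s) (cycle_minors s) (cycle_det s)"
proof (cases "odd (s 2)")
  case True
  have *: "even (s i) \<Longrightarrow> even (s j)" if "i \<le> j" "j < 8" for i j
    using s that unfolding sorted_2adic_def by (metis power_one_right)
  have "odd (s 1)" using *[of 1 2] True by auto
  show ?thesis
  proof
    assume "splits_over_int (cycle_trace s) (cycle_minors s) (cycle_det s)"
    from splits_over_int_parity[OF this] show False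
      using True s0 \<open>odd (s 1)\<close> *[of 3 4] *[of 4 5] *[of 5 6] *[of 6 7]
      unfolding cycle_trace_def cycle_minors_def cycle_det_def by auto
  qed
next
  case False
  have *: "2^k dvd s i \<Longrightarrow> 2^k dvd s j" if "i \<le> j" "j < 8" for i j k
    using s that unfolding sorted_2adic_def by blast
  obtain l c where c: "s 2 = 2^l * c" "odd c" using odd_part[OF s2] by blast
  have "s 1 \<noteq> 0"
  proof
    assume "s 1 = 0"
    then have "2^Suc l dvd s 2" using *[of 1 2 "Suc l"] by auto
    then show False using pow2_dvd_odd[OF c(2), of "Suc l" l] c(1) by simp
  qed
  then obtain m b where b: "s 1 = 2^m * b" "odd b" using odd_part by blast
  have "2^m dvd s 2" using *[of 1 2 m] b by auto
  then have ml: "m \<le> l" using pow2_dvd_odd[OF c(2)] c(1) by auto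
  have l: "0 < l" using False c by (cases l) auto
  have "2^l dvd s j" if "2 \<le> j" "j < 8" for j using *[of 2 j l] c that by auto
  then have "2^l dvd s 3" "2^l dvd s 4" "2^l dvd s 5" "2^l dvd s 6" "2^l dvd s 7" by auto
  then obtain s3 s4 s5 s6 s7 where r: "s 3 = 2^l * s3" "s 4 = 2^l * s4" "s 5 = 2^l * s5"
    "s 6 = 2^l * s6" "s 7 = 2^l * s7" unfolding dvd_def by blast
  have L: "(2::int)^l = 2^m * 2^(l-m)" using ml by (simp flip: power_add)
  show ?thesis
  proof (rule not_split_single_slope[where l = l and t = "m + l"])
    show "2^l dvd cycle_trace s" unfolding cycle_trace_def r by simp
    have "cycle_minors s = 2^(m+l) * (2^(l-m) * (s3*s4 + s3*s5 + s4*s5 - s7*c) - b * s6)"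
      unfolding cycle_minors_def r b c power_add by (simp add: L algebra_simps)
    then show "2^(m+l) dvd cycle_minors s" by simp
    show "cycle_det s = 2^(m+l) * (s 0 * b * c + 2^l * (2^(l-m) * (s3*s4*s5 - s7*s4*c) - s3*b*s6))"
      unfolding cycle_det_def r b c power_add by (simp add: L algebra_simps)
    show "odd (s 0 * b * c + 2^l * (2^(l-m) * (s3*s4*s5 - s7*s4*c) - s3*b*s6))"
      using s0 b c l by simp
  qed (use l ml in auto)
qed

lemma cycle_block_not_split:
  assumes s: "sorted_2adic s" and s2: "s 2 \<noteq> 0"
  shows "\<not> splits_over_int (cycle_trace s) (cycle_minors s) (cycle_det s)"
proof
  assume split: "splits_over_int (cycle_trace s) (cycle_minors s) (cycle_det s)"
  have *: "2^k dvd s i \<Longrightarrow> 2^k dvd s j" if "i \<le> j" "j < 8" for i j k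
    using s that unfolding sorted_2adic_def by blast
  have "s 0 \<noteq> 0"
  proof
    assume "s 0 = 0"
    obtain l c where c: "s 2 = 2^l * c" "odd c" using odd_part[OF s2] by blast
    have "2^Suc l dvd s 2" using *[of 0 2 "Suc l"] \<open>s 0 = 0\<close> by auto
    then show False using pow2_dvd_odd[OF c(2), of "Suc l" l] c(1) by simp
  qed
  then obtain u c where c: "s 0 = 2^u * c" "odd c" using odd_part by blast
  \<comment> \<open>The valuation of \<open>s 0\<close> is the smallest one, so its power of two divides all entries.\<close>
  define s' where "s' i = s i div 2^u" for i
  have s': "s i = 2^u * s' i" if "i < 8" for i
    using *[of 0 i u] c that unfolding s'_def by auto
  have "sorted_2adic s'" unfolding sorted_2adic_def
  proof (intro allI impI)
    fix i j k assume ij: "i \<le> j" "j < 8" and "2^k dvd s' i"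
    then have "2^(u+k) dvd s i" using s'[of i] by (simp add: power_add)
    then have "2^(u+k) dvd s j" using * ij by blast
    then show "2^k dvd s' j" using s'[of j] ij by (simp add: power_add)
  qed
  moreover have "odd (s' 0)" using c s'[of 0] by simp
  moreover have "s' 2 \<noteq> 0" using s2 s'[of 2] by auto
  moreover have "splits_over_int (cycle_trace s') (cycle_minors s') (cycle_det s')"
  proof (rule splits_over_int_descent[of u])
    have "cycle_trace s = 2^u * cycle_trace s'" unfolding cycle_trace_def by (simp add: s' algebra_simps)
    moreover have "cycle_minors s = 2^(2*u) * cycle_minors s'"
      unfolding cycle_minors_def by (simp add: s' algebra_simps power2_eq_square power_mult)
    moreover have "cycle_det s = 2^(3*u) * cycle_det s'"
      unfolding cycle_det_def by (simp add: s' algebra_simps power3_eq_cube power_mult)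
    ultimately show "splits_over_int (2^u * cycle_trace s') (2^(2*u) * cycle_minors s') (2^(3*u) * cycle_det s')"
      using split by simp
  qed
  ultimately show False using cycle_block_not_split_odd by blast
qed

section \<open>Spectra of block triangular matrices\<close>

lemma det_3:
  assumes "(A :: 'a :: comm_ring_1 mat) \<in> carrier_mat 3 3"
  shows "det A =
     A $$ (0,0) * (A $$ (1,1) * A $$ (2,2) - A $$ (1,2) * A $$ (2,1))
   - A $$ (0,1) * (A $$ (1,0) * A $$ (2,2) - A $$ (1,2) * A $$ (2,0))
   + A $$ (0,2) * (A $$ (1,0) * A $$ (2,1) - A $$ (1,1) * A $$ (2,0))"
proof -
  have det2: "det M = M $$ (0,0) * M $$ (1,1) - M $$ (0,1) * M $$ (1,0)"
    if M: "M \<in> carrier_mat 2 2" for M :: "'a mat"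
  proof -
    have 1: "mat_delete M i j \<in> carrier_mat 1 1" for i j
      using mat_delete_carrier[OF M, of i j] by simp
    show ?thesis
      using M unfolding laplace_expansion_row[OF M, of 0, simplified]
      by (simp add: cofactor_def numeral_2_eq_2 det_single[OF 1])
         (simp add: mat_delete_def)
  qed
  have 2: "mat_delete A i j \<in> carrier_mat 2 2" for i j
    using mat_delete_carrier[OF assms, of i j] by simp
  show ?thesis
    using assms unfolding laplace_expansion_row[OF assms, of 0, simplified]
    by (simp add: cofactor_def numeral_3_eq_3 det2[OF 2, unfolded numeral_2_eq_2])
       (simp add: mat_delete_def numeral_2_eq_2 algebra_simps)
qed

text \<open>The complex characteristic polynomial splits, its roots are eigenvalues and hence integers, and
comparing values at \<open>0\<close>, \<open>1\<close> and \<open>-1\<close> identifies its coefficients.\<close>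

lemma integral_spectrum_3_splits_over_int:
  assumes A: "A \<in> carrier_mat 3 3" and sp: "integral_spectrum A"
  shows "splits_over_int (A $$ (0,0) + A $$ (1,1) + A $$ (2,2))
     (A $$ (0,0) * A $$ (1,1) - A $$ (0,1) * A $$ (1,0)
      + A $$ (0,0) * A $$ (2,2) - A $$ (0,2) * A $$ (2,0)
      + A $$ (1,1) * A $$ (2,2) - A $$ (1,2) * A $$ (2,1)) (det A)"
    (is "splits_over_int ?e1 ?e2 _")
proof -
  define C where "C = map_mat complex_of_int A"
  have C: "C \<in> carrier_mat 3 3" using A unfolding C_def by simp
  obtain as where as: "char_poly C = (\<Prod>a\<leftarrow>as. [:- a, 1:])" "length as = 3"
    using char_poly_factorized[OF C] by blast
  then obtain x y z where xyz: "as = [x, y, z]"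
    by (auto simp: length_Suc_conv numeral_3_eq_3)
  have ev: "k \<in> \<int>" if "poly (char_poly C) k = 0" for k
  proof -
    have "k \<in> spectrum C"
      using that eigenvalue_root_char_poly[OF C] unfolding spectrum_def by auto
    then show ?thesis using sp unfolding integral_spectrum_def C_def by blast
  qed
  have p: "poly (char_poly C) k = (k - x) * (k - y) * (k - z)" for k
    unfolding as xyz by (simp add: algebra_simps)
  obtain x' y' z' where ints: "x = of_int x'" "y = of_int y'" "z = of_int z'"
    using ev[of x] ev[of y] ev[of z] by (auto simp: p elim!: Ints_cases)
  have q: "poly (char_poly C) (of_int k) =
     of_int (k^3 - ?e1 * k^2 + ?e2 * k - det A)" for k
  proof -
    have M: "- char_matrix C (of_int k) \<in> carrier_mat 3 3" using C by simp
    show ?thesis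
      unfolding char_poly_matrix[OF C] det_3[OF M] det_3[OF A] using A
      by (simp add: char_matrix_def C_def) (simp add: algebra_simps power2_eq_square power3_eq_cube)
  qed
  have "(k - x') * (k - y') * (k - z') = k^3 - ?e1 * k^2 + ?e2 * k - det A" for k
  proof -
    have "complex_of_int ((k - x') * (k - y') * (k - z')) = of_int (k^3 - ?e1 * k^2 + ?e2 * k - det A)"
      using p[of "of_int k"] q[of k] unfolding ints by simp
    then show ?thesis by (simp only: of_int_eq_iff)
  qed
  from this[of 0] this[of 1] this[of "-1"]
  have "?e1 = x' + y' + z' \<and> ?e2 = x'*y' + x'*z' + y'*z' \<and> det A = x'*y'*z'"
    by (simp add: algebra_simps)
  then show ?thesis unfolding splits_over_int_def by blast
qed

text \<open>If the lower left block of a matrix vanishes, an eigenvector of the upper left block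
extended by zeros is an eigenvector of the whole matrix.\<close>

lemma integral_spectrum_leading_block:
  assumes A: "A \<in> carrier_mat n n" and mn: "m \<le> n"
    and zero: "\<And>i j. m \<le> i \<Longrightarrow> i < n \<Longrightarrow> j < m \<Longrightarrow> A $$ (i,j) = 0"
    and sp: "integral_spectrum A"
  shows "integral_spectrum (mat m m (\<lambda>ij. A $$ ij))"
  unfolding integral_spectrum_def
proof
  let ?B = "map_mat complex_of_int (mat m m (\<lambda>ij. A $$ ij))"
  let ?C = "map_mat complex_of_int A"
  fix k assume "k \<in> spectrum ?B"
  then obtain v where v: "v \<in> carrier_vec m" "v \<noteq> 0\<^sub>v m" "?B *\<^sub>v v = k \<cdot>\<^sub>v v"
    unfolding spectrum_def eigenvalue_def eigenvector_def by auto
  define w where "w = vec n (\<lambda>i. if i < m then v $ i else 0)"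
  obtain i where i: "i < m" "v $ i \<noteq> 0" using v(1,2) by (metis carrier_vecD eq_vecI index_zero_vec)
  have "w \<noteq> 0\<^sub>v n"
  proof
    assume "w = 0\<^sub>v n"
    then have "w $ i = 0" using i mn by simp
    then show False using i mn unfolding w_def by simp
  qed
  moreover have "?C *\<^sub>v w = k \<cdot>\<^sub>v w"
  proof
    fix r assume "r < dim_vec (k \<cdot>\<^sub>v w)"
    then have r: "r < n" unfolding w_def by simp
    have "(?C *\<^sub>v w) $ r = (\<Sum>j = 0..<n. of_int (A $$ (r,j)) * w $ j)"
      using A r unfolding w_def by (simp add: scalar_prod_def)
    also have "\<dots> = (\<Sum>j = 0..<m. of_int (A $$ (r,j)) * v $ j)"
      using mn by (intro sum.mono_neutral_cong_right) (auto simp: w_def)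
    also have "\<dots> = k * w $ r"
    proof (cases "r < m")
      case True
      have "(?B *\<^sub>v v) $ r = (\<Sum>j = 0..<m. of_int (A $$ (r,j)) * v $ j)"
        using v(1) True by (simp add: scalar_prod_def)
      then show ?thesis using v True mn unfolding w_def by simp
    next
      case False
      then show ?thesis using zero r by (simp add: w_def)
    qed
    finally show "(?C *\<^sub>v w) $ r = (k \<cdot>\<^sub>v w) $ r" using r by (simp add: w_def)
  qed (use A in \<open>auto simp: w_def\<close>)
  moreover have "w \<in> carrier_vec n" unfolding w_def by simp
  ultimately have "k \<in> spectrum ?C" using A
    unfolding spectrum_def eigenvalue_def eigenvector_def by auto
  then show "k \<in> \<int>" using sp unfolding integral_spectrum_def by blast
qed

text \<open>The positions that \<open>s 0, ..., s 7\<close> occupy in the \<open>3 \<times> 3\<close> matrix whose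
coefficients are \<^const>\<open>cycle_trace\<close>, \<^const>\<open>cycle_minors\<close> and \<^const>\<open>cycle_det\<close>. Position \<open>(1,0)\<close>
is the one left out.\<close>

definition block_cells :: "(nat \<times> nat) list" where
  "block_cells = [(0,1), (1,2), (2,0), (0,0), (1,1), (2,2), (2,1), (0,2)]"

lemma block_not_integral_spectrum:
  assumes A: "A \<in> carrier_mat n n" and n: "n \<ge> 3"
    and zero: "A $$ (1,0) = 0" "\<And>i j. 3 \<le> i \<Longrightarrow> i < n \<Longrightarrow> j < 3 \<Longrightarrow> A $$ (i,j) = 0"
    and s: "sorted_2adic s" "s 2 \<noteq> 0"
    and As: "\<And>k. k < 8 \<Longrightarrow> A $$ (block_cells ! k) = s k"
  shows "\<not> integral_spectrum A"
proof
  let ?B = "mat 3 3 (\<lambda>ij. A $$ ij)"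
  assume "integral_spectrum A"
  then have "integral_spectrum ?B"
    using integral_spectrum_leading_block[OF A n zero(2)] by simp
  note split = integral_spectrum_3_splits_over_int[OF mat_carrier this]
  have E: "A $$ (0,1) = s 0" "A $$ (1,2) = s 1" "A $$ (2,0) = s 2" "A $$ (0,0) = s 3"
    "A $$ (1,1) = s 4" "A $$ (2,2) = s 5" "A $$ (2,1) = s 6" "A $$ (0,2) = s 7"
    using As[of 0] As[of 1] As[of 2] As[of 3] As[of 4] As[of 5] As[of 6] As[of 7]
    unfolding block_cells_def by (simp_all add: eval_nat_numeral)
  have "splits_over_int (cycle_trace s) (cycle_minors s) (cycle_det s)"
    using split unfolding det_3[OF mat_carrier] cycle_trace_def cycle_minors_def cycle_det_def
    by (simp add: E zero E[unfolded One_nat_def] zero(1)[unfolded One_nat_def] algebra_simps)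
  then show False using cycle_block_not_split[OF s] by blast
qed

section \<open>Arranging a multiset in a matrix\<close>

definition fill_mat :: "nat \<Rightarrow> (nat \<times> nat) list \<Rightarrow> int list \<Rightarrow> int mat" where
  "fill_mat n ps xs =
     mat n n (\<lambda>p. case map_of (zip ps xs) p of None \<Rightarrow> 0 | Some x \<Rightarrow> x)"

lemma fill_mat_nth:
  assumes "distinct ps" "length ps = length xs" "k < length ps" "ps ! k \<in> {..<n} \<times> {..<n}"
  shows "fill_mat n ps xs $$ (ps ! k) = xs ! k"
proof -
  have "map_of (zip ps xs) (ps ! k) = Some (xs ! k)"
    using assms by (intro map_of_zip_nth) auto
  then show ?thesis using assms(4) by (auto simp: fill_mat_def)
qed

lemma fill_mat_outside:
  assumes "length ps = length xs" "p \<in> {..<n} \<times> {..<n} - set ps"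
  shows "fill_mat n ps xs $$ p = 0"
proof -
  have "map_of (zip ps xs) p = None" using assms by simp
  then show ?thesis using assms(2) by (auto simp: fill_mat_def)
qed

text \<open>The only data needed to produce a matrix with prescribed entries are distinct positions for
the entries in \<open>xs\<close>; these must include all nonzero ones and may include some zeros.\<close>

lemma fill_mat_in_mats_of:
  assumes ps: "distinct ps" "length ps = length xs" "set ps \<subseteq> {..<n} \<times> {..<n}"
    and S: "S = mset xs + replicate_mset (n^2 - length xs) 0"
  shows "fill_mat n ps xs \<in> mats_of n S"
proof -
  let ?A = "fill_mat n ps xs" and ?P = "{..<n} \<times> {..<n}"
  have "map (\<lambda>p. ?A $$ p) ps = xs"
  proof (rule nth_equalityI)
    fix i assume "i < length (map (\<lambda>p. ?A $$ p) ps)"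
    then show "map (\<lambda>p. ?A $$ p) ps ! i = xs ! i"
      using fill_mat_nth[OF ps(1,2), of i n] ps(2,3) nth_mem[of i ps]
      by (metis length_map nth_map subsetD)
  qed (use ps in simp)
  then have 1: "image_mset (\<lambda>p. ?A $$ p) (mset_set (set ps)) = mset xs"
    using ps(1) by (metis mset_map mset_set_set)
  have "image_mset (\<lambda>p. ?A $$ p) (mset_set (?P - set ps)) = image_mset (\<lambda>p. 0) (mset_set (?P - set ps))"
    by (intro image_mset_cong) (use fill_mat_outside[OF ps(2)] in auto)
  also have "\<dots> = replicate_mset (n^2 - length xs) 0"
    using ps by (simp add: image_mset_const_eq card_Diff_subset distinct_card power2_eq_square)
  finally have 2: "image_mset (\<lambda>p. ?A $$ p) (mset_set (?P - set ps)) = replicate_mset (n^2 - length xs) 0" .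
  have "mset_set ?P = mset_set (set ps) + mset_set (?P - set ps)"
    using ps(3) by (metis List.finite_set finite_Diff finite_SigmaI finite_lessThan mset_set_Union
        Diff_disjoint Un_Diff_cancel sup.absorb2)
  with 1 2 have "entries_mset ?A = S"
    unfolding entries_mset_def S by (simp add: fill_mat_def)
  then show ?thesis unfolding mats_of_def by (simp add: fill_mat_def)
qed

lemma nonzero_zero_decomp:
  "S = filter_mset (\<lambda>x. x \<noteq> 0) S + replicate_mset (size S - density S) (0::int)"
proof -
  have *: "filter_mset (\<lambda>x. \<not> x \<noteq> 0) S = replicate_mset (count S 0) 0"
    by (simp add: filter_eq_replicate_mset)
  have S: "S = filter_mset (\<lambda>x. x \<noteq> 0) S + replicate_mset (count S 0) 0"
    using multiset_partition[of S "\<lambda>x. x \<noteq> 0"] unfolding * .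
  have "size S = density S + count S 0"
    using arg_cong[OF S, of size] unfolding density_def
    by (simp only: size_union size_replicate_mset)
  then have "size S - density S = count S 0" by simp
  then show ?thesis using S by (simp only:)
qed

text \<open>Only the nonzero entries are sorted, and zeros are appended: the multiplicity of 2 in \<open>0\<close> is \<open>0\<close>
by convention, while the order treats the valuation of \<open>0\<close> as infinite.\<close>

lemma sorted_2adic_listing:
  assumes "8 \<le> N" "3 \<le> density S" "density S \<le> N" "N \<le> size S"
  obtains xs where "length xs = N" "S = mset xs + replicate_mset (size S - N) 0"
    "sorted_2adic (\<lambda>k. xs ! k)" "xs ! 2 \<noteq> 0"
proof -
  let ?v = "multiplicity (2::int)"
  obtain ys where ys: "mset ys = filter_mset (\<lambda>x. x \<noteq> 0) S" by (metis ex_mset)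
  define L where "L = sort_key ?v ys"
  have mL: "mset L = filter_mset (\<lambda>x. x \<noteq> 0) S" unfolding L_def using ys by simp
  have lenL: "length L = density S" unfolding density_def by (metis mL size_mset)
  have nz: "L ! k \<noteq> 0" if "k < length L" for k
  proof -
    have "L ! k \<in># mset L" using that by simp
    then show ?thesis unfolding mL by simp
  qed
  have sorted: "sorted (map ?v L)" unfolding L_def by simp
  define xs where "xs = L @ replicate (N - density S) 0"
  have len: "length xs = N" unfolding xs_def using lenL assms by simp
  have "sorted_2adic (\<lambda>k. xs ! k)" unfolding sorted_2adic_def
  proof (intro allI impI)
    fix i j k :: nat assume ij: "i \<le> j" "j < 8" and d: "2^k dvd xs ! i"
    show "2^k dvd xs ! j"
    proof (cases "j < length L")
      case True
      then have "?v (L ! i) \<le> ?v (L ! j)"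
        using sorted_nth_mono[OF sorted ij(1)] ij by simp
      moreover have "k \<le> ?v (L ! i)" using d True ij nz[of i]
        by (simp add: xs_def nth_append power_dvd_iff_le_multiplicity)
      ultimately show ?thesis using True nz[of j]
        by (simp add: xs_def nth_append power_dvd_iff_le_multiplicity)
    next
      case False
      then show ?thesis using ij len assms(1) lenL unfolding xs_def by (simp add: nth_append)
    qed
  qed
  moreover have "xs ! 2 \<noteq> 0" using nz[of 2] lenL assms(2) by (simp add: xs_def nth_append)
  moreover have "S = mset xs + replicate_mset (size S - N) 0"
  proof -
    have "size S - density S = (N - density S) + (size S - N)" using assms by simp
    then have "replicate_mset (size S - density S) (0::int) =
      replicate_mset (N - density S) 0 + replicate_mset (size S - N) 0"
      by (intro multiset_eqI) simp
    then show ?thesis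
      using nonzero_zero_decomp[of S] unfolding xs_def by (simp add: mL add.assoc)
  qed
  ultimately show thesis using that len by blast
qed

text \<open>The zeros needed are \<open>3 * (n - 3)\<close> below the leading \<open>3 \<times> 3\<close> block and one inside of it, in
total \<open>3 * n - 8\<close>, which is the number that the density bound provides. The first eight terms of
the valuation-ordered listing go into the block; the remaining terms fill the other positions
in any order.\<close>

lemma not_PSI_density_ge_3:
  assumes n: "n \<ge> 3" and S: "size S = n^2" "3 \<le> density S" "density S + 3 * n \<le> n^2 + 8"
  shows "\<not> PSI n S"
proof -
  define Z where "Z = insert (1,0) ({3..<n} \<times> {..<(3::nat)})"
  define R where "R = {..<n} \<times> {..<n} - Z"
  define N where "N = n^2 + 8 - 3 * n"
  have ZP: "Z \<subseteq> {..<n} \<times> {..<n}" using n unfolding Z_def by auto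
  have "card Z = 3 * (n - 3) + 1" unfolding Z_def by (simp add: card_insert_if)
  then have cR: "card R = N"
    using ZP n unfolding R_def N_def
    by (subst card_Diff_subset) (auto simp: power2_eq_square Z_def)
  have n2: "3 * n \<le> n^2" using n by (simp add: power2_eq_square)
  have N8: "8 \<le> N" "density S \<le> N" "N \<le> size S" using n2 S n unfolding N_def by simp_all
  then obtain xs where xs: "length xs = N" "S = mset xs + replicate_mset (size S - N) 0"
    "sorted_2adic (\<lambda>k. xs ! k)" "xs ! 2 \<noteq> 0" using sorted_2adic_listing S(2) by metis
  have fin: "finite (R - set block_cells)" unfolding R_def by simp
  obtain qs where qs: "set qs = R - set block_cells" "distinct qs"
    using finite_distinct_list[OF fin] by blast
  define ps where "ps = block_cells @ qs"
  have bR: "set block_cells \<subseteq> R" using n unfolding block_cells_def R_def Z_def by auto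
  have set: "set ps = R" using qs bR unfolding ps_def by auto
  have dist: "distinct ps" using qs unfolding ps_def block_cells_def by auto
  have len: "length ps = length xs" using distinct_card[OF dist] set cR xs(1) by simp
  define A where "A = fill_mat n ps xs"
  have "A \<in> mats_of n S" unfolding A_def
    using dist len set xs(1,2) S(1) by (intro fill_mat_in_mats_of) (auto simp: R_def)
  moreover have "\<not> integral_spectrum A"
  proof (rule block_not_integral_spectrum[OF _ n _ _ xs(3,4)])
    show "A \<in> carrier_mat n n" unfolding A_def fill_mat_def by simp
    have z: "A $$ p = 0" if "p \<in> Z" for p
      unfolding A_def using len set that ZP by (intro fill_mat_outside) (auto simp: R_def)
    show "A $$ (1,0) = 0" by (intro z) (simp add: Z_def)
    show "A $$ (i,j) = 0" if "3 \<le> i" "i < n" "j < 3" for i j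
      using that by (intro z) (simp add: Z_def)
    show "A $$ (block_cells ! k) = xs ! k" if k: "k < 8" for k
    proof -
      have k': "k < length block_cells" using k unfolding block_cells_def by simp
      then have "block_cells ! k = ps ! k" unfolding ps_def by (simp add: nth_append)
      moreover have "k < length ps" using k' unfolding ps_def by simp
      moreover from this have "ps ! k \<in> {..<n} \<times> {..<n}" using set nth_mem unfolding R_def by blast
      ultimately show ?thesis unfolding A_def using fill_mat_nth[OF dist len] by simp
    qed
  qed
  ultimately show ?thesis unfolding PSI_def by blast
qed

section \<open>Two nonzero entries\<close>

text \<open>Placed symmetrically to the diagonal, \<open>a\<close> and \<open>b\<close> produce the eigenvalues plus and minus \<open>sqrt (a * b)\<close>.\<close>

lemma PSI_two_entries_imp_square:
  assumes n: "n \<ge> 2" and psi: "PSI n ({#a, b#} + replicate_mset (n^2 - 2) 0)" and a: "a \<noteq> 0"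
  shows "\<exists>q. a * b = q^2"
proof -
  define A where "A = fill_mat n [(0,1),(1,0)] [a, b]"
  have "A \<in> mats_of n ({#a, b#} + replicate_mset (n^2 - 2) 0)"
    unfolding A_def using n
    by (intro fill_mat_in_mats_of) (auto simp: add_mset_commute numeral_2_eq_2)
  then have "integral_spectrum A" using psi unfolding PSI_def by blast
  define C where "C = map_mat complex_of_int A"
  define r where "r = csqrt (of_int (a * b))"
  define v where "v = vec n (\<lambda>i. if i = 0 then of_int a else if i = 1 then r else 0)"
  have rr: "r * r = of_int a * of_int b"
    using power2_csqrt[of "of_int (a*b)"] unfolding r_def power2_eq_square by simp
  have "v \<noteq> 0\<^sub>v n"
  proof
    assume "v = 0\<^sub>v n"
    then have "v $ 0 = 0" using n by simp
    then show False using n a unfolding v_def by simp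
  qed
  moreover have "C *\<^sub>v v = r \<cdot>\<^sub>v v"
  proof
    fix i assume "i < dim_vec (r \<cdot>\<^sub>v v)"
    then have i: "i < n" unfolding v_def by simp
    have "(C *\<^sub>v v) $ i = (\<Sum>j = 0..<n. of_int (A $$ (i,j)) * v $ j)"
      using i unfolding C_def A_def fill_mat_def v_def by (simp add: scalar_prod_def)
    also have "\<dots> = (\<Sum>j \<in> {0,1}. of_int (A $$ (i,j)) * v $ j)"
      using n by (intro sum.mono_neutral_right) (auto simp: v_def)
    also have "\<dots> = r * v $ i"
      using n i rr by (auto simp: v_def A_def fill_mat_def)
    finally show "(C *\<^sub>v v) $ i = (r \<cdot>\<^sub>v v) $ i" using i by (simp add: v_def)
  qed (auto simp: v_def C_def A_def fill_mat_def)
  moreover have "v \<in> carrier_vec n" unfolding v_def by simp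
  ultimately have "r \<in> spectrum C"
    unfolding spectrum_def eigenvalue_def eigenvector_def C_def A_def fill_mat_def by auto
  then have "r \<in> \<int>" using \<open>integral_spectrum A\<close> unfolding integral_spectrum_def C_def by blast
  then obtain q where "r = of_int q" by (auto elim: Ints_cases)
  then have "complex_of_int (a * b) = of_int (q^2)" using rr by (simp add: power2_eq_square)
  then show ?thesis by (metis of_int_eq_iff)
qed

lemma entries_mset_two:
  assumes A: "A \<in> carrier_mat n n" and E: "entries_mset A = {#a, b#} + replicate_mset m 0"
  obtains p p' where "p \<noteq> p'" "A $$ p = a" "A $$ p' = b" "p \<in> {..<n} \<times> {..<n}" "p' \<in> {..<n} \<times> {..<n}"
    "\<And>i j. i < n \<Longrightarrow> j < n \<Longrightarrow> (i,j) \<noteq> p \<Longrightarrow> (i,j) \<noteq> p' \<Longrightarrow> A $$ (i,j) = 0"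
proof -
  let ?P = "mset_set ({..<n} \<times> {..<n})"
  have "image_mset (\<lambda>p. A $$ p) ?P = add_mset a (add_mset b (replicate_mset m 0))"
    using A E unfolding entries_mset_def by (auto simp: add_mset_commute)
  then obtain M p where p: "?P = add_mset p M" "A $$ p = a"
     "image_mset (\<lambda>p. A $$ p) M = add_mset b (replicate_mset m 0)"
    by (auto dest!: msed_map_invR)
  from p(3) obtain M' p' where p': "M = add_mset p' M'" "A $$ p' = b"
     "image_mset (\<lambda>p. A $$ p) M' = replicate_mset m 0"
    by (auto dest!: msed_map_invR)
  have P: "?P = {#p, p'#} + M'" using p(1) p'(1) by simp
  have "p \<noteq> p'"
  proof
    assume "p = p'"
    then have "count ?P p \<ge> 2" unfolding P by simp
    then show False using count_mset_set'[of "{..<n} \<times> {..<n}" p] by (simp split: if_splits)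
  qed
  moreover have "p \<in># ?P" "p' \<in># ?P" unfolding P by auto
  moreover have "A $$ (i,j) = 0" if "i < n" "j < n" "(i,j) \<noteq> p" "(i,j) \<noteq> p'" for i j
  proof -
    have "(i,j) \<in># ?P" using that by simp
    then have "(i,j) \<in># M'" using that unfolding P by auto
    then have "A $$ (i,j) \<in># image_mset (\<lambda>p. A $$ p) M'" by simp
    then show ?thesis unfolding p'(3) by (simp split: if_splits)
  qed
  ultimately show thesis using that[of p p'] p(2) p'(2) by simp
qed

text \<open>An eigenvector for a nonzero eigenvalue is supported on the rows that contain \<open>a\<close> or \<open>b\<close>. In such
a row its coordinate can be nonzero only if the coordinate at the column of an entry is nonzero,
so this column is again the index of one of these rows. Either an entry lies on the
diagonal and is the eigenvalue, or the two entries are opposite to each other and the eigenvalue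
has square \<open>a * b\<close>. Zero is allowed for \<open>a\<close> and \<open>b\<close>, so that multisets with
fewer than two nonzero entries are included.\<close>

lemma integral_spectrum_two_entries:
  assumes A: "A \<in> carrier_mat n n" and E: "entries_mset A = {#a, b#} + replicate_mset m 0"
    and q: "a * b = q^2"
  shows "integral_spectrum A"
  unfolding integral_spectrum_def
proof
  let ?C = "map_mat complex_of_int A"
  fix k assume "k \<in> spectrum ?C"
  then obtain v where v: "v \<in> carrier_vec n" "v \<noteq> 0\<^sub>v n" "?C *\<^sub>v v = k \<cdot>\<^sub>v v"
    using A unfolding spectrum_def eigenvalue_def eigenvector_def by auto
  obtain p p' where pp: "p \<noteq> p'" "A $$ p = a" "A $$ p' = b"
      "p \<in> {..<n} \<times> {..<n}" "p' \<in> {..<n} \<times> {..<n}"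
      "\<And>r s. r < n \<Longrightarrow> s < n \<Longrightarrow> (r,s) \<noteq> p \<Longrightarrow> (r,s) \<noteq> p' \<Longrightarrow> A $$ (r,s) = 0"
    using entries_mset_two[OF A E] by blast
  obtain i j i' j' where ij: "p = (i,j)" "p' = (i',j')" by fastforce
  have p: "(i,j) \<noteq> (i',j')" "A $$ (i,j) = a" "A $$ (i',j') = b"
      "i < n" "j < n" "i' < n" "j' < n"
    and zero: "\<And>r s. r < n \<Longrightarrow> s < n \<Longrightarrow> (r,s) \<noteq> (i,j) \<Longrightarrow> (r,s) \<noteq> (i',j') \<Longrightarrow> A $$ (r,s) = 0"
    using pp unfolding ij by auto
  have eq: "k * v $ r = (if r = i then of_int a * v $ j else 0) + (if r = i' then of_int b * v $ j' else 0)"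
    if r: "r < n" for r
  proof -
    have "k * v $ r = (?C *\<^sub>v v) $ r" unfolding v(3) using v(1) r by simp
    also have "\<dots> = (\<Sum>s<n. of_int (A $$ (r,s)) * v $ s)"
      using A v(1) r by (simp add: scalar_prod_def atLeast0LessThan)
    also have "\<dots> = (\<Sum>s<n. (if s = j then if r = i then of_int a * v $ j else 0 else 0) +
                      (if s = j' then if r = i' then of_int b * v $ j' else 0 else 0))"
      using p zero[OF r] by (intro sum.cong) auto
    also have "\<dots> = (if r = i then of_int a * v $ j else 0) + (if r = i' then of_int b * v $ j' else 0)"
      using p by (simp add: sum.distrib)
    finally show ?thesis .
  qed
  obtain r where r: "r < n" "v $ r \<noteq> 0" using v(1,2) by (metis carrier_vecD eq_vecI index_zero_vec)
  have "k = 0 \<or> k = of_int a \<or> k = of_int b \<or> k * k = of_int (a * b)"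
  proof (rule ccontr)
    assume neg: "\<not> ?thesis"
    have supp: "s = i \<or> s = i'" if "s < n" "v $ s \<noteq> 0" for s
      using eq[OF that(1)] that(2) neg by (auto split: if_splits)
    show False
    proof (cases "i = i'")
      case True
      have ri: "r = i" using supp[OF r] True by blast
      have "j \<noteq> j'" using p(1) True by simp
      then have "v $ j = 0 \<or> v $ j' = 0"
        using supp[OF p(5)] supp[OF p(7)] True by metis
      then show False
        using eq[OF p(4)] neg supp[OF p(5)] supp[OF p(7)] r(2) True unfolding ri
        by (cases "v $ j = 0"; cases "v $ j' = 0") auto
    next
      case False
      have i: "k * v $ i = of_int a * v $ j" using eq[OF p(4)] False by simp
      have i': "k * v $ i' = of_int b * v $ j'" using eq[OF p(6)] False by simp
      \<comment> \<open>The rows differ and the eigenvalue is neither \<open>a\<close> nor \<open>b\<close>, so the entries are opposite to each other.\<close>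
      have step: "v $ i \<noteq> 0 \<Longrightarrow> j = i' \<and> v $ i' \<noteq> 0" "v $ i' \<noteq> 0 \<Longrightarrow> j' = i \<and> v $ i \<noteq> 0"
      proof -
        assume vi: "v $ i \<noteq> 0"
        then have "v $ j \<noteq> 0" using i neg by auto
        moreover from this have "j \<noteq> i" using i neg by auto
        ultimately show "j = i' \<and> v $ i' \<noteq> 0" using supp[OF p(5)] by metis
      next
        assume vi': "v $ i' \<noteq> 0"
        then have "v $ j' \<noteq> 0" using i' neg by auto
        moreover from this have "j' \<noteq> i'" using i' neg by auto
        ultimately show "j' = i \<and> v $ i \<noteq> 0" using supp[OF p(7)] by metis
      qed
      have ne: "v $ i \<noteq> 0" "v $ i' \<noteq> 0" "j = i'" "j' = i"
        using step supp[OF r] r(2) by metis+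
      have "k * k * v $ i = k * (of_int a * v $ i')" using i ne by simp
      also have "\<dots> = of_int a * (k * v $ i')" by simp
      also have "\<dots> = of_int a * (of_int b * v $ i)" using i' ne by simp
      finally have "(k * k - of_int (a * b)) * v $ i = 0" by (simp add: algebra_simps)
      then show False using neg ne by simp
    qed
  qed
  moreover have "k \<in> \<int>" if "k * k = of_int (a * b)"
  proof -
    have "(k - of_int q) * (k + of_int q) = 0" using that q by (simp add: algebra_simps power2_eq_square)
    then have "k = of_int q \<or> k = of_int (- q)" by (auto simp: eq_neg_iff_add_eq_0)
    then show ?thesis by auto
  qed
  ultimately show "k \<in> \<int>" by auto
qed

section \<open>Classification\<close>

theorem theorem4p1:
  fixes n :: nat
  assumes "n \<ge> 3"
  shows
    "(\<forall>S :: int multiset.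
        size S = n^2 \<and> int (density S) \<le> int n ^ 2 - 3 * int n + 8 \<longrightarrow>
        (PSI n S \<longleftrightarrow>
          density S \<le> 1 \<or>
          (\<exists>a b q :: int. S = {#a, b#} + replicate_mset (n^2 - 2) 0 \<and>
             a \<noteq> 0 \<and> b \<noteq> 0 \<and> a * b = q^2)))
     \<and> \<not> (\<exists>S :: int multiset.
            size S = n^2 \<and> PSI n S \<and>
            3 \<le> density S \<and> int (density S) \<le> int n ^ 2 - 3 * int n + 8)"
proof -
  have bound: "density S + 3 * n \<le> n^2 + 8"
    if "int (density S) \<le> int n ^ 2 - 3 * int n + 8" for S
  proof -
    have "int (density S + 3 * n) \<le> int (n^2 + 8)" using that by simp
    then show ?thesis by (simp only: of_nat_le_iff)
  qed
  have high: "\<not> PSI n S"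
    if "size S = n^2" "3 \<le> density S" "int (density S) \<le> int n ^ 2 - 3 * int n + 8" for S
    using not_PSI_density_ge_3[OF assms that(1,2) bound[OF that(3)]] .
  have two: "PSI n ({#a, b#} + replicate_mset m 0)" if "a * b = q^2" for a b q :: int and m
    using that integral_spectrum_two_entries unfolding PSI_def mats_of_def by blast
  have n2: "n^2 = Suc (Suc (n^2 - 2))"
    using assms power_mono[of 3 n 2] by simp
  have "PSI n S \<longleftrightarrow> density S \<le> 1 \<or>
          (\<exists>a b q :: int. S = {#a, b#} + replicate_mset (n^2 - 2) 0 \<and>
             a \<noteq> 0 \<and> b \<noteq> 0 \<and> a * b = q^2)" (is "_ \<longleftrightarrow> _ \<or> ?form")
    if S: "size S = n^2" "int (density S) \<le> int n ^ 2 - 3 * int n + 8" for S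
  proof
    assume psi: "PSI n S"
    then have "density S < 3" using high[OF S(1) _ S(2)] by force
    then have "density S \<le> 1 \<or> density S = 2" by linarith
    moreover have ?form if d: "density S = 2"
    proof -
      have s2: "size (filter_mset (\<lambda>x. x \<noteq> 0) S) = Suc (Suc 0)"
        using d unfolding density_def by simp
      then obtain a F where F: "filter_mset (\<lambda>x. x \<noteq> 0) S = add_mset a F"
        using size_eq_Suc_imp_eq_union by blast
      then have "size F = 1" using s2 by simp
      then obtain b where "F = {#b#}" using size_1_singleton_mset by blast
      with F have ab: "filter_mset (\<lambda>x. x \<noteq> 0) S = {#a, b#}" by simp
      have S': "S = {#a, b#} + replicate_mset (n^2 - 2) 0"
        using nonzero_zero_decomp[of S] unfolding ab S(1) d .
      have "a \<in># filter_mset (\<lambda>x. x \<noteq> 0) S" "b \<in># filter_mset (\<lambda>x. x \<noteq> 0) S"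
        unfolding ab by simp_all
      then have "a \<noteq> 0" "b \<noteq> 0" by simp_all
      then show ?thesis
        using PSI_two_entries_imp_square[of n a b] psi S' assms by auto
    qed
    ultimately show "density S \<le> 1 \<or> ?form" by blast
  next
    assume "density S \<le> 1 \<or> ?form"
    then show "PSI n S"
    proof
      assume d: "density S \<le> 1"
      have "\<exists>a m. S = {#a, 0#} + replicate_mset m 0"
      proof (cases "density S = 0")
        case True
        then have e: "filter_mset (\<lambda>x. x \<noteq> 0) S = {#}" unfolding density_def by simp
        have "S = replicate_mset (n^2) 0"
          using nonzero_zero_decomp[of S] unfolding S(1) True e by simp
        also have "\<dots> = {#0, 0#} + replicate_mset (n^2 - 2) 0"
          by (subst n2) simp
        finally show ?thesis by blast
      next
        case False
        then have d1: "density S = 1" using d by linarith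
        then have "size (filter_mset (\<lambda>x. x \<noteq> 0) S) = 1" unfolding density_def .
        then obtain a where a: "filter_mset (\<lambda>x. x \<noteq> 0) S = {#a#}"
          using size_1_singleton_mset by blast
        have "S = {#a#} + replicate_mset (n^2 - 1) 0"
          using nonzero_zero_decomp[of S] d1 unfolding S(1) a by simp
        also have "n^2 - 1 = Suc (n^2 - 2)" using n2 by linarith
        finally have "S = {#a, 0#} + replicate_mset (n^2 - 2) 0" by simp
        then show ?thesis by blast
      qed
      then show ?thesis using two[of _ 0 0] by auto
    qed (use two in auto)
  qed
  then show ?thesis using high by blast
qed

end
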